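(* Let $n \ge 1$ and $\ell \ge 2$ be integers, and let $x^0=(x^0_1,\dots,x^0_n)\in\mathbb{Z}^n$ satisfy $x^0_1\le\dots\le x^0_n$, have at least one entry that is a multiple of $\ell$, and satisfy $\mathrm{range}(x^0)> \ell$. Let $x^0\to x^1\to\dots\to x^j\to\dots$ be the GM-sequence starting at $x^0$. Then there exists an integer $N\ge 0$ such that $\mathrm{range}(x^j)>\ell$ for all $0\le j\le N$ and $\mathrm{range}(x^j)\le\ell$ for all $j>N$.
   Context: Notation: $[n]=\{1,\dots,n\}$. Entries of vectors are integers and may be negative; $0$ and negative multiples count as multiples of $\ell$. For a vector with $x_1\le\dots\le x_n$, $\mathrm{range}(x)=x_n-x_1$. Pivot: let $x=(x_1,\dots,x_n)$ be an integer vector with $x_1\le \dots\le x_n$ having at least one entry that is a multiple of $\ell$. Among the entries of $x$ that are multiples of $\ell$, take the minimal value; the pivot of $x$, $\mathrm{pivot}(x)\in[n]$, is the largest index $i$ such that $x_i$ equals this value. GM-move: the GM-move $x\to x'$ keeps the pivotal entry ($x'_i=x_i$ for $i=\mathrm{pivot}(x)$) and reduces each of the other $n-1$ entries by $1$ ($x'_k=x_k-1$ for $k\ne i$). The vector $x'$ again satisfies $x'_1\le\dots\le x'_n$ and has an entry that is a multiple of $\ell$. The GM-sequence starting at $x^0$ is the infinite sequence $x^0\to x^1\to x^2\to\dots$ of successive GM-moves. *)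

theory Defs
  imports Main
begin

(* A vector in Z^n is a function x :: nat => int of which only the entries x 1, ..., x n matter,
   so that indices agree with [n] = {1..n}. *)

definition has_multiple :: "nat \<Rightarrow> int \<Rightarrow> (nat \<Rightarrow> int) \<Rightarrow> bool" where
  "has_multiple n l x \<longleftrightarrow> (\<exists>i\<in>{1..n}. l dvd x i)"

definition vec_range :: "nat \<Rightarrow> (nat \<Rightarrow> int) \<Rightarrow> int" where
  "vec_range n x = x n - x 1"

definition min_multiple :: "nat \<Rightarrow> int \<Rightarrow> (nat \<Rightarrow> int) \<Rightarrow> int" where
  "min_multiple n l x = Min {x i | i. i \<in> {1..n} \<and> l dvd x i}"

(* Meaningful only if has_multiple n l x; otherwise Min and Max are taken over an empty set. *)
definition pivot :: "nat \<Rightarrow> int \<Rightarrow> (nat \<Rightarrow> int) \<Rightarrow> nat" where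
  "pivot n l x = Max {i \<in> {1..n}. x i = min_multiple n l x}"

definition gm_move :: "nat \<Rightarrow> int \<Rightarrow> (nat \<Rightarrow> int) \<Rightarrow> (nat \<Rightarrow> int)" where
  "gm_move n l x = (\<lambda>k. if k \<in> {1..n} \<and> k \<noteq> pivot n l x then x k - 1 else x k)"

definition gm_seq :: "nat \<Rightarrow> int \<Rightarrow> (nat \<Rightarrow> int) \<Rightarrow> nat \<Rightarrow> (nat \<Rightarrow> int)" where
  "gm_seq n l x0 j = (gm_move n l ^^ j) x0"

end

(* In the moving frame y = x + j the entries are particles on the integer line, and at time j the
   leftmost particle whose position is congruent to j mod l advances by one.  The particle that
   has just advanced is eligible again, so a "hopper" travels to the right at unit speed until some
   particle lies at a positive multiple of l behind it; then the hopper jumps back to that particle.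
   After a jump the hopper is at least l behind the rightmost particle.  To push the rightmost
   particle again, it has to sweep the last l positions without jumping, so it meets every residue
   class and no particle is left l or more behind: the range is then less than l.  Hence, as long as
   the range exceeds l, the rightmost particle is eventually at rest while each step brings one
   particle closer to it, which cannot go on forever.  Finally, a range of at most l stays so,
   because the range cannot grow from l: then x 1 = x n - l is a smaller multiple of l than x n. *)
theory Submission
  imports Defs
begin

section \<open>Minimal multiple and pivot of a sorted vector\<close>

definition admissible :: "nat \<Rightarrow> int \<Rightarrow> (nat \<Rightarrow> int) \<Rightarrow> bool" where
  "admissible n l x \<longleftrightarrow> mono_on {1..n} x \<and> has_multiple n l x"

lemma has_multiple_pos: "has_multiple n l x \<Longrightarrow> 1 \<le> n"
  by (auto simp: has_multiple_def)

lemma min_multiple_props: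
  assumes "has_multiple n l x"
  shows min_multiple_attained: "\<exists>i\<in>{1..n}. x i = min_multiple n l x"
    and min_multiple_dvd: "l dvd min_multiple n l x"
    and min_multiple_le: "\<And>i. i \<in> {1..n} \<Longrightarrow> l dvd x i \<Longrightarrow> min_multiple n l x \<le> x i"
proof -
  let ?A = "{x i | i. i \<in> {1..n} \<and> l dvd x i}"
  have A: "finite ?A" "?A \<noteq> {}"
    using assms by (auto simp: has_multiple_def)
  from Min_in[OF A] show "\<exists>i\<in>{1..n}. x i = min_multiple n l x" "l dvd min_multiple n l x"
    by (auto simp: min_multiple_def)
  show "min_multiple n l x \<le> x i" if "i \<in> {1..n}" "l dvd x i" for i
    unfolding min_multiple_def using A(1) that by (intro Min_le) auto
qed

lemma pivot_props:
  assumes "has_multiple n l x"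
  shows pivot_in: "pivot n l x \<in> {1..n}"
    and pivot_eq: "x (pivot n l x) = min_multiple n l x"
    and pivot_ge: "\<And>i. i \<in> {1..n} \<Longrightarrow> x i = min_multiple n l x \<Longrightarrow> i \<le> pivot n l x"
proof -
  let ?A = "{i \<in> {1..n}. x i = min_multiple n l x}"
  have A: "finite ?A" "?A \<noteq> {}"
    using min_multiple_attained[OF assms] by auto
  from Max_in[OF A] show "pivot n l x \<in> {1..n}" "x (pivot n l x) = min_multiple n l x"
    by (auto simp: pivot_def)
  show "i \<le> pivot n l x" if "i \<in> {1..n}" "x i = min_multiple n l x" for i
    unfolding pivot_def using A(1) that by (intro Max_ge) auto
qed

lemma gm_move_pivot: "gm_move n l x (pivot n l x) = x (pivot n l x)"
  by (simp add: gm_move_def)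

lemma gm_move_other: "k \<in> {1..n} \<Longrightarrow> k \<noteq> pivot n l x \<Longrightarrow> gm_move n l x k = x k - 1"
  by (simp add: gm_move_def)

lemma has_multiple_gm_move:
  assumes "has_multiple n l x"
  shows "has_multiple n l (gm_move n l x)"
  using pivot_in[OF assms] pivot_eq[OF assms] min_multiple_dvd[OF assms] gm_move_pivot[of n l x]
  unfolding has_multiple_def by metis

text \<open>Order could only break between the pivot and a later entry. The pivot is the last index
  carrying its value, so such an entry is strictly larger and survives the decrement.\<close>

lemma admissible_gm_move:
  assumes "admissible n l x"
  shows "admissible n l (gm_move n l x)"
proof -
  from assms have mono: "mono_on {1..n} x" and hm: "has_multiple n l x"
    by (auto simp: admissible_def)
  have "gm_move n l x i \<le> gm_move n l x k" if ik: "i \<in> {1..n}" "k \<in> {1..n}" "i \<le> k" for i k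
  proof (cases "i = pivot n l x \<and> k \<noteq> i")
    case True
    then have "x k \<noteq> x i"
      using pivot_ge[OF hm ik(2)] pivot_eq[OF hm] ik(3) by auto
    with mono_onD[OF mono ik] True ik show ?thesis
      by (simp add: gm_move_def)
  next
    case False
    with mono_onD[OF mono ik] ik show ?thesis
      by (auto simp: gm_move_def)
  qed
  then have "mono_on {1..n} (gm_move n l x)"
    by (intro mono_onI)
  with has_multiple_gm_move[OF hm] show ?thesis
    by (simp add: admissible_def)
qed

lemma admissible_bounds:
  assumes "admissible n l x"
  shows admissible_le_last: "i \<in> {1..n} \<Longrightarrow> x i \<le> x n"
    and first_le_min_multiple: "x 1 \<le> min_multiple n l x"
    and min_multiple_le_last: "min_multiple n l x \<le> x n"
proof -
  from assms have mono: "mono_on {1..n} x" and hm: "has_multiple n l x"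
    by (auto simp: admissible_def)
  show le: "x i \<le> x n" if "i \<in> {1..n}" for i
    using mono_onD[OF mono, of i n] that by auto
  obtain i where i: "i \<in> {1..n}" "x i = min_multiple n l x"
    using min_multiple_attained[OF hm] by blast
  show "min_multiple n l x \<le> x n"
    using le[OF i(1)] i(2) by simp
  show "x 1 \<le> min_multiple n l x"
    using mono_onD[OF mono, of 1 i] i by auto
qed

lemma min_multiple_gm_move_le:
  assumes "has_multiple n l x"
  shows "min_multiple n l (gm_move n l x) \<le> min_multiple n l x"
  using min_multiple_le[OF has_multiple_gm_move[OF assms] pivot_in[OF assms]]
    pivot_eq[OF assms] min_multiple_dvd[OF assms] by (simp add: gm_move_pivot)

lemma pivot_eq_last_iff:
  assumes "admissible n l x"
  shows "pivot n l x = n \<longleftrightarrow> min_multiple n l x = x n"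
proof -
  from assms have hm: "has_multiple n l x"
    by (simp add: admissible_def)
  show ?thesis
    using pivot_eq[OF hm] pivot_ge[OF hm, of n] pivot_in[OF hm] has_multiple_pos[OF hm] by force
qed

lemma vec_range_gm_move_le:
  assumes "admissible n l x" and "0 < l" and "vec_range n x \<le> l"
  shows "vec_range n (gm_move n l x) \<le> l"
proof -
  from assms have hm: "has_multiple n l x"
    by (simp add: admissible_def)
  have n: "1 \<in> {1..n}" "n \<in> {1..n}"
    using has_multiple_pos[OF hm] by auto
  show ?thesis
  proof (cases "vec_range n x = l \<and> pivot n l x = n")
    case True
    then have "min_multiple n l x = x n" "x 1 = x n - l"
      using pivot_eq_last_iff[OF assms(1)] by (auto simp: vec_range_def)
    with min_multiple_dvd[OF hm] min_multiple_le[OF hm n(1)] \<open>0 < l\<close> have False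
      by (simp add: dvd_diff)
    then show ?thesis ..
  next
    case False
    \<comment> \<open>If the pivot is not \<open>n\<close>, entry \<open>n\<close> drops at least as
      much as entry 1; otherwise the range is below \<open>l\<close> and grows by at most
      one.\<close>
    then show ?thesis
      using assms n by (auto simp: vec_range_def gm_move_def)
  qed
qed

section \<open>Jumps of the hopper and swept residue classes\<close>

text \<open>A drop of the minimal multiple is a jump of the hopper.\<close>

lemma min_multiple_drop:
  assumes "admissible n l x" and "0 < l"
    and "min_multiple n l (gm_move n l x) \<noteq> min_multiple n l x"
  shows "min_multiple n l (gm_move n l x) \<le> gm_move n l x n - l"
proof -
  let ?m = "min_multiple n l x" and ?m' = "min_multiple n l (gm_move n l x)"
  from assms have hm: "has_multiple n l x"
    by (simp add: admissible_def)
  have n: "n \<in> {1..n}"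
    using has_multiple_pos[OF hm] by auto
  have "?m' < ?m"
    using min_multiple_gm_move_le[OF hm] assms(3) by simp
  moreover have "l dvd ?m - ?m'"
    using min_multiple_dvd[OF hm] min_multiple_dvd[OF has_multiple_gm_move[OF hm]] by simp
  ultimately have "l \<le> ?m - ?m'"
    by (intro zdvd_imp_le) auto
  \<comment> \<open>If entry \<open>n\<close> is decremented, it was strictly above the minimal
    multiple.\<close>
  moreover have "?m \<le> gm_move n l x n"
    using pivot_eq_last_iff[OF assms(1)] min_multiple_le_last[OF assms(1)] n
    by (auto simp: gm_move_def)
  ultimately show ?thesis
    by simp
qed

text \<open>The hopper sits at the minimal multiple; on its way through the last \<open>l\<close> positions it has left
  no entry behind in the residue classes that it has met.\<close>

definition swept :: "nat \<Rightarrow> int \<Rightarrow> (nat \<Rightarrow> int) \<Rightarrow> bool" where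
  "swept n l x \<longleftrightarrow> (\<forall>i\<in>{1..n}. \<forall>s. x n - l < s \<and> s \<le> min_multiple n l x \<and> x i < s
     \<longrightarrow> \<not> l dvd s - x i)"

text \<open>With the pivot at \<open>n\<close>, the positions \<open>s\<close> in
  \<open>swept\<close> run through all residues mod \<open>l\<close>, so an entry \<open>l\<close>
  or more behind would be detected.\<close>

lemma swept_pivot_last_range:
  assumes "admissible n l x" and "0 < l" and "swept n l x" and "pivot n l x = n"
  shows "vec_range n x < l"
proof (rule ccontr)
  assume "\<not> vec_range n x < l"
  then have far: "x 1 \<le> x n - l"
    by (simp add: vec_range_def)
  have m: "min_multiple n l x = x n"
    using assms pivot_eq_last_iff by blast
  have n: "1 \<in> {1..n}"
    using assms(1) has_multiple_pos by (auto simp: admissible_def)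
  \<comment> \<open>The one among the last \<open>l\<close> positions that is congruent to
    \<open>x 1\<close> mod \<open>l\<close>.\<close>
  define s where "s = x n - (x n - x 1) mod l"
  have "s - x 1 = (x n - x 1) - (x n - x 1) mod l"
    by (simp add: s_def)
  then have "l dvd s - x 1"
    by (metis dvd_minus_mod)
  moreover have "x n - l < s" "s \<le> x n"
    using \<open>0 < l\<close> pos_mod_bound[of l "x n - x 1"] pos_mod_sign[of l "x n - x 1"]
    by (auto simp: s_def)
  ultimately show False
    using assms(3) n m far unfolding swept_def by force
qed

text \<open>A jump empties the window of positions \<open>s\<close>. Otherwise the window shifts
  down by one together with the non-pivotal entries and gains only the minimal multiple
  itself.\<close>

lemma swept_gm_move:
  assumes "admissible n l x" and "0 < l" and "swept n l x" and "pivot n l x \<noteq> n"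
  shows "swept n l (gm_move n l x)"
proof (cases "min_multiple n l (gm_move n l x) = min_multiple n l x")
  case False
  with min_multiple_drop[OF assms(1,2)] show ?thesis
    by (force simp: swept_def)
next
  case same: True
  let ?m = "min_multiple n l x"
  from assms have hm: "has_multiple n l x"
    by (simp add: admissible_def)
  have n: "n \<in> {1..n}"
    using has_multiple_pos[OF hm] by auto
  have last: "gm_move n l x n = x n - 1"
    using gm_move_other[OF n] assms(4) by auto
  show ?thesis
    unfolding swept_def
  proof (intro ballI allI impI notI)
    fix i s
    assume i: "i \<in> {1..n}"
      and s: "gm_move n l x n - l < s \<and> s \<le> min_multiple n l (gm_move n l x) \<and> gm_move n l x i < s"
      and d: "l dvd s - gm_move n l x i"
    have "i \<noteq> pivot n l x"
      using s same pivot_eq[OF hm] gm_move_pivot[of n l x] by auto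
    then have xi: "gm_move n l x i = x i - 1"
      using gm_move_other[OF i] by auto
    show False
    proof (cases "s = ?m")
      case True
      \<comment> \<open>At the new position, an entry left behind would be a multiple of
        \<open>l\<close> below the minimal one.\<close>
      then have "l dvd gm_move n l x i"
        using d min_multiple_dvd[OF hm] by (metis dvd_diff_right_iff dvd_diff_commute)
      then have "?m \<le> gm_move n l x i"
        using min_multiple_le[OF has_multiple_gm_move[OF hm] i] same by simp
      with s True show False
        by simp
    next
      case False
      then have "x n - l < s + 1" "s + 1 \<le> ?m" "x i < s + 1"
        using s same last xi by auto
      moreover have "s + 1 - x i = s - gm_move n l x i"
        using xi by simp
      ultimately show False
        using assms(3) i d unfolding swept_def by metis
    qed
  qed
qed

section \<open>Long-run behaviour of the sequence\<close>

lemma gm_seq_0 [simp]: "gm_seq n l x 0 = x"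
  by (simp add: gm_seq_def)

lemma gm_seq_Suc [simp]: "gm_seq n l x (Suc j) = gm_move n l (gm_seq n l x j)"
  by (simp add: gm_seq_def)

lemma gm_seq_add: "gm_seq n l x (i + j) = gm_seq n l (gm_seq n l x i) j"
  by (simp add: gm_seq_def add.commute[of i] funpow_add)

lemma admissible_gm_seq: "admissible n l x \<Longrightarrow> admissible n l (gm_seq n l x j)"
  by (induction j) (auto intro: admissible_gm_move)

text \<open>While the minimal multiple stays put, entry 1 is never pivotal, falls by one per move
  and so becomes a smaller multiple of \<open>l\<close>.\<close>

lemma min_multiple_eventually_drops:
  assumes "admissible n l x" and "0 < l" and "x 1 < min_multiple n l x"
  shows "\<exists>j. min_multiple n l (gm_seq n l x (Suc j)) \<noteq> min_multiple n l (gm_seq n l x j)"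
proof (rule ccontr)
  assume "\<not> ?thesis"
  then have const: "min_multiple n l (gm_seq n l x j) = min_multiple n l x" for j
    by (induction j) (auto simp del: gm_seq_Suc)
  have n: "1 \<in> {1..n}"
    using assms(1) has_multiple_pos by (auto simp: admissible_def)
  have first: "gm_seq n l x j 1 = x 1 - int j" for j
  proof (induction j)
    case (Suc j)
    have "has_multiple n l (gm_seq n l x j)"
      using admissible_gm_seq[OF assms(1)] by (simp add: admissible_def)
    then have "pivot n l (gm_seq n l x j) \<noteq> 1"
      using pivot_eq const[of j] Suc assms(3) by fastforce
    then show ?case
      using gm_move_other[OF n, of l "gm_seq n l x j"] Suc by auto
  qed simp
  \<comment> \<open>The number of moves that bring entry 1 down to a multiple of
    \<open>l\<close>.\<close>
  define k where "k = nat (x 1 mod l)"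
  have "gm_seq n l x k 1 = x 1 - x 1 mod l"
    using first[of k] \<open>0 < l\<close> by (simp add: k_def)
  then have "l dvd gm_seq n l x k 1"
    by (metis dvd_minus_mod)
  moreover have "has_multiple n l (gm_seq n l x k)"
    using admissible_gm_seq[OF assms(1)] by (simp add: admissible_def)
  ultimately have "min_multiple n l x \<le> gm_seq n l x k 1"
    using min_multiple_le[OF _ n] const by metis
  with first[of k] assms(3) show False
    by simp
qed

text \<open>Entry \<open>n\<close> falls together with all entries but the pivotal one, so exactly
  one gap shrinks.\<close>

lemma sum_gap_gm_move:
  assumes "admissible n l x" and "pivot n l x \<noteq> n"
  shows "(\<Sum>i=1..n. gm_move n l x n - gm_move n l x i) = (\<Sum>i=1..n. x n - x i) - 1"
proof -
  let ?p = "pivot n l x"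
  from assms have hm: "has_multiple n l x"
    by (simp add: admissible_def)
  have n: "n \<in> {1..n}"
    using has_multiple_pos[OF hm] by auto
  have "(\<Sum>i=1..n. gm_move n l x n - gm_move n l x i)
      = (\<Sum>i=1..n. (x n - x i) - (if i = ?p then 1 else 0))"
    using n assms(2) by (intro sum.cong) (auto simp: gm_move_def)
  also have "\<dots> = (\<Sum>i=1..n. x n - x i) - 1"
    using pivot_in[OF hm] by (simp add: sum_subtractf)
  finally show ?thesis .
qed

lemma pivot_last_recurs:
  assumes "admissible n l x"
  shows "\<exists>j. pivot n l (gm_seq n l x j) = n"
proof (rule ccontr)
  assume "\<not> ?thesis"
  then have np: "pivot n l (gm_seq n l x j) \<noteq> n" for j
    by blast
  define gap where "gap y = (\<Sum>i=1..n. y n - y i)" for y :: "nat \<Rightarrow> int"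
  have nonneg: "0 \<le> gap (gm_seq n l x j)" for j
    using admissible_le_last[OF admissible_gm_seq[OF assms]]
    by (auto simp: gap_def intro!: sum_nonneg)
  have "gap (gm_seq n l x j) = gap x - int j" for j
  proof (induction j)
    case (Suc j)
    then show ?case
      using sum_gap_gm_move[OF admissible_gm_seq[OF assms] np] by (simp add: gap_def)
  qed simp
  from this[of "nat (gap x) + 1"] nonneg[of 0] nonneg[of "nat (gap x) + 1"] show False
    by simp
qed

lemma vec_range_eventually_le:
  assumes "admissible n l x" and "0 < l"
  shows "\<exists>j. vec_range n (gm_seq n l x j) \<le> l"
proof (rule ccontr)
  assume "\<not> ?thesis"
  then have big: "l < vec_range n (gm_seq n l x j)" for j
    by (simp add: not_le)
  note adm = admissible_gm_seq[OF assms(1)]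
  show False
  proof (cases "\<exists>j. gm_seq n l x j 1 < min_multiple n l (gm_seq n l x j)")
    case True
    then obtain j where "gm_seq n l x j 1 < min_multiple n l (gm_seq n l x j)" ..
    from min_multiple_eventually_drops[OF adm assms(2) this]
    obtain d where d: "min_multiple n l (gm_seq n l x (Suc d)) \<noteq> min_multiple n l (gm_seq n l x d)"
      by (metis gm_seq_add add_Suc_right)
    let ?y = "gm_seq n l x (Suc d)"
    \<comment> \<open>Right after a drop no position \<open>s\<close> qualifies, so
      \<open>swept\<close> holds vacuously.\<close>
    have start: "swept n l ?y"
      using min_multiple_drop[OF adm assms(2), of d] d by (force simp: swept_def)
    \<comment> \<open>A pivot at \<open>n\<close> would force a range below \<open>l\<close>,
      against \<open>big\<close>; hence \<open>swept\<close> propagates forever.\<close>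
    have no_last: "pivot n l (gm_seq n l ?y k) \<noteq> n" if "swept n l (gm_seq n l ?y k)" for k
      using swept_pivot_last_range[OF admissible_gm_seq[OF adm] assms(2) that]
        big[of "Suc d + k"] by (fastforce simp only: gm_seq_add)
    have "swept n l (gm_seq n l ?y k)" for k
    proof (induction k)
      case 0
      show ?case
        using start by (simp only: gm_seq_0)
    next
      case (Suc k)
      show ?case
        using swept_gm_move[OF admissible_gm_seq[OF adm] assms(2) Suc no_last[OF Suc]]
        by (simp only: gm_seq_Suc)
    qed
    with no_last pivot_last_recurs[OF adm] show False
      by blast
  next
    case False
    \<comment> \<open>Entry 1 is always the minimal multiple, and entry \<open>n\<close> lies more
      than \<open>l\<close> above it.\<close>
    then have "min_multiple n l (gm_seq n l x j) = gm_seq n l x j 1" for j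
      using first_le_min_multiple[OF adm, of j] by (meson not_less order.antisym)
    then have "pivot n l (gm_seq n l x j) \<noteq> n" for j
      using pivot_eq_last_iff[OF adm, of j] big[of j] \<open>0 < l\<close> by (auto simp: vec_range_def)
    with pivot_last_recurs[OF assms(1)] show False
      by blast
  qed
qed

theorem mainTheorem4:
  fixes n :: nat and l :: int and x0 :: "nat \<Rightarrow> int"
  assumes "n \<ge> 1" and "l \<ge> 2"
    and "mono_on {1..n} x0"
    and "has_multiple n l x0"
    and "vec_range n x0 > l"
  shows "\<exists>N::nat. (\<forall>j\<le>N. vec_range n (gm_seq n l x0 j) > l) \<and>
                  (\<forall>j>N. vec_range n (gm_seq n l x0 j) \<le> l)"
proof -
  let ?P = "\<lambda>j. vec_range n (gm_seq n l x0 j) \<le> l"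
  have adm: "admissible n l x0" and l: "0 < l"
    using assms by (auto simp: admissible_def)
  \<comment> \<open>\<open>Suc N\<close> is the first time with range at most \<open>l\<close>; it
    is positive because the range exceeds \<open>l\<close> at time 0.\<close>
  have "\<exists>N. (\<forall>j\<le>N. \<not> ?P j) \<and> ?P (Suc N)"
    using ex_least_nat_less[of ?P] vec_range_eventually_le[OF adm l] assms(5) by auto
  then obtain N where N: "\<forall>j\<le>N. \<not> ?P j" "?P (Suc N)"
    by blast
  have "?P j" if "Suc N \<le> j" for j
    using that
  proof (induction j rule: dec_induct)
    case base
    show ?case by (rule N(2))
  next
    case (step j)
    then show ?case
      using vec_range_gm_move_le[OF admissible_gm_seq[OF adm] l] by simp
  qed
  with N(1) show ?thesis
    by (metis Suc_leI not_le)
qed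

end
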